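(* (Formula for Airy functions.) The solutions of the Airy equation $u''-xu=0$ on $\mathbb{R}$ are given by $u=u(0)\,u_1+u'(0)\,u_2$, where, for $x\ge 0$, $$u_1(x)=1+\sum_{j=1}^\infty\ \int_{0<s_1<\cdots<s_{2j}<x}s_1s_3\cdots s_{2j-1}\,ds_1ds_2\cdots ds_{2j},$$ $$u_2(x)=\sum_{j=1}^\infty\ \int_{0<s_1<\cdots<s_{2j-1}<x}s_2s_4\cdots s_{2j-2}\,ds_1ds_2\cdots ds_{2j-1},$$ and, for $x\le 0$, $$u_1(x)=1+\sum_{j=1}^\infty\ \int_{x<s_{2j}<\cdots<s_1<0}s_1s_3\cdots s_{2j-1}\,ds_1ds_2\cdots ds_{2j},$$ $$u_2(x)=-\sum_{j=1}^\infty\ \int_{x<s_{2j-1}<\cdots<s_1<0}s_2s_4\cdots s_{2j-2}\,ds_1ds_2\cdots ds_{2j-1}.$$ In particular, the standard Airy functions are $$\mathrm{Ai}=\frac{u_1}{3^{2/3}\Gamma(\frac23)}-\frac{u_2}{3^{1/3}\Gamma(\frac13)}\qquad\text{and}\qquad \mathrm{Bi}=\frac{u_1}{3^{1/6}\Gamma(\frac23)}+\frac{3^{1/6}u_2}{\Gamma(\frac13)}.$$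
   Context: For $j=1$ the empty product $s_2s_4\cdots s_{2j-2}$ in the formulas for $u_2$ equals $1$. The standard Airy functions $\mathrm{Ai}$ and $\mathrm{Bi}$ are the solutions of $u''-xu=0$ with $\mathrm{Ai}(0)=\frac{1}{3^{2/3}\Gamma(2/3)}$, $\mathrm{Ai}'(0)=-\frac{1}{3^{1/3}\Gamma(1/3)}$, $\mathrm{Bi}(0)=\frac{1}{3^{1/6}\Gamma(2/3)}$, $\mathrm{Bi}'(0)=\frac{3^{1/6}}{\Gamma(1/3)}$. *)

theory Defs
  imports "HOL-Analysis.Analysis"
begin

definition airy_solution :: "(real \<Rightarrow> 'a::real_normed_field) \<Rightarrow> bool" where
  "airy_solution u \<longleftrightarrow>
     (\<exists>u'. (\<forall>x. (u has_vector_derivative u' x) (at x)) \<and>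
           (\<forall>x. (u' has_vector_derivative of_real x * u x) (at x)))"

text \<open>Lebesgue measure on the space of tuples \<open>(s 1, \<dots>, s n)\<close>,
  represented as extensional functions on \<open>{1..n}\<close>.\<close>

abbreviation tuple_measure :: "nat \<Rightarrow> (nat \<Rightarrow> real) measure" where
  "tuple_measure n \<equiv> (\<Pi>\<^sub>M i\<in>{1..n}. lborel)"

text \<open>The regions \<open>0 < s 1 < \<dots> < s n < x\<close> and \<open>x < s n < \<dots> < s 1 < 0\<close>
  (used only for \<open>n \<ge> 1\<close>).\<close>

definition increasing_tuples :: "nat \<Rightarrow> real \<Rightarrow> (nat \<Rightarrow> real) set" where
  "increasing_tuples n x =
     {s \<in> {1..n} \<rightarrow>\<^sub>E UNIV. 0 < s 1 \<and> (\<forall>i\<in>{1..<n}. s i < s (i + 1)) \<and> s n < x}"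

definition decreasing_tuples :: "nat \<Rightarrow> real \<Rightarrow> (nat \<Rightarrow> real) set" where
  "decreasing_tuples n x =
     {s \<in> {1..n} \<rightarrow>\<^sub>E UNIV. x < s n \<and> (\<forall>i\<in>{1..<n}. s (i + 1) < s i) \<and> s 1 < 0}"

text \<open>\<open>s 1 * s 3 * \<dots> * s (2 * j - 1)\<close> and \<open>s 2 * s 4 * \<dots> * s (2 * j - 2)\<close>, for \<open>j \<ge> 1\<close>;
  the second product is empty for \<open>j = 1\<close>.\<close>

definition odd_product :: "nat \<Rightarrow> (nat \<Rightarrow> real) \<Rightarrow> real" where
  "odd_product j s = (\<Prod>i=1..j. s (2 * i - 1))"

definition even_product :: "nat \<Rightarrow> (nat \<Rightarrow> real) \<Rightarrow> real" where
  "even_product j s = (\<Prod>i=1..j - 1. s (2 * i))"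

definition u1_right_term :: "nat \<Rightarrow> real \<Rightarrow> real" where
  "u1_right_term j x =
     (LINT s:increasing_tuples (2 * j) x|tuple_measure (2 * j). odd_product j s)"

definition u1_left_term :: "nat \<Rightarrow> real \<Rightarrow> real" where
  "u1_left_term j x =
     (LINT s:decreasing_tuples (2 * j) x|tuple_measure (2 * j). odd_product j s)"

definition u2_right_term :: "nat \<Rightarrow> real \<Rightarrow> real" where
  "u2_right_term j x =
     (LINT s:increasing_tuples (2 * j - 1) x|tuple_measure (2 * j - 1). even_product j s)"

definition u2_left_term :: "nat \<Rightarrow> real \<Rightarrow> real" where
  "u2_left_term j x =
     (LINT s:decreasing_tuples (2 * j - 1) x|tuple_measure (2 * j - 1). even_product j s)"

text \<open>Sums over \<open>j \<ge> 1\<close> are written as sums over all \<open>j\<close> of the term with index \<open>Suc j\<close>.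
  At \<open>x = 0\<close> all regions are empty, so the choice of branch is immaterial.\<close>

definition airy_u1 :: "real \<Rightarrow> real" where
  "airy_u1 x = (if 0 \<le> x then 1 + (\<Sum>j. u1_right_term (Suc j) x)
           else 1 + (\<Sum>j. u1_left_term (Suc j) x))"

definition airy_u2 :: "real \<Rightarrow> real" where
  "airy_u2 x = (if 0 \<le> x then (\<Sum>j. u2_right_term (Suc j) x)
           else - (\<Sum>j. u2_left_term (Suc j) x))"

definition Ai :: "real \<Rightarrow> real" where
  "Ai = (THE u. airy_solution u \<and>
           u 0 = 1 / (3 powr (2/3) * Gamma (2/3)) \<and>
           vector_derivative u (at 0) = - 1 / (3 powr (1/3) * Gamma (1/3)))"

definition Bi :: "real \<Rightarrow> real" where
  "Bi = (THE u. airy_solution u \<and>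
           u 0 = 1 / (3 powr (1/6) * Gamma (2/3)) \<and>
           vector_derivative u (at 0) = 3 powr (1/6) / Gamma (1/3))"

end

(*
  The integrals over s_1 < ... < s_n are computed one variable at a time: by Tonelli, integrating out
  the innermost variables first turns c * y^k into c / (k + e + 1) * x^(k + e + 1), where e is 0 or 1
  according to whether the new variable occurs in the product. Two steps divide by (k + 2) (k + 3),
  which is exactly the recursion for the Taylor coefficients of solutions of u'' = x u; so the sums
  are the two power series solutions. For x <= 0 every variable changes sign. Any other solution is a
  combination of these two because Wronskians of solutions are constant; this needs no completeness
  of the field of values.
*)
theory Submission
  imports Defs
begin

section \<open>Iterated integrals over ordered simplices\<close>

text \<open>With \<open>\<sigma> = 1\<close> this is the region for \<open>x \<ge> 0\<close>, and with \<open>\<sigma> = -1\<close> the one for \<open>- x \<le> 0\<close>. Bounding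
  every coordinate, not only the extreme ones, makes \<open>n = 0\<close> a correct base case.\<close>

definition signed_simplex :: "real \<Rightarrow> nat \<Rightarrow> real \<Rightarrow> (nat \<Rightarrow> real) set" where
  "signed_simplex \<sigma> n x =
     {s \<in> space (tuple_measure n). (\<forall>i\<in>{1..n}. 0 < \<sigma> * s i \<and> \<sigma> * s i < x) \<and>
        (\<forall>j\<in>{1..n}. \<forall>i\<in>{1..<j}. \<sigma> * s i < \<sigma> * s j)}"

text \<open>The sign sits inside every factor, so the weight is nonnegative on the simplex for
  either sign and Tonelli applies. The exponents \<open>e\<close> select the coordinates that occur
  in the product.\<close>

definition monomial_weight :: "(nat \<Rightarrow> nat) \<Rightarrow> real \<Rightarrow> nat \<Rightarrow> (nat \<Rightarrow> real) \<Rightarrow> real" where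
  "monomial_weight e \<sigma> n s = (\<Prod>i\<in>{1..n}. (\<sigma> * s i) ^ e i)"

lemma measurable_coordinate [measurable (raw)]:
  "i \<in> I \<Longrightarrow> (\<lambda>s. s i) \<in> borel_measurable (\<Pi>\<^sub>M i\<in>I. lborel :: real measure)"
  using measurable_component_singleton[of i I "\<lambda>_. lborel :: real measure"] by simp

lemma signed_simplex_sets [measurable]: "signed_simplex \<sigma> n x \<in> sets (tuple_measure n)"
proof -
  have coord: "(\<lambda>s. \<sigma> * s i) \<in> borel_measurable (tuple_measure n)" if "i \<in> {1..n}" for i
    using measurable_coordinate[OF that] by (rule borel_measurable_const[THEN borel_measurable_times])
  have bounds: "Measurable.pred (tuple_measure n) (\<lambda>s. 0 < \<sigma> * s i \<and> \<sigma> * s i < x)"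
    if "i \<in> {1..n}" for i
    using coord[OF that] by measurable
  have chain: "Measurable.pred (tuple_measure n) (\<lambda>s. \<sigma> * s i < \<sigma> * s j)"
    if "j \<in> {1..n}" "i \<in> {1..<j}" for i j
  proof -
    from that have i: "i \<in> {1..n}"
      by auto
    show ?thesis
      using coord[OF i] coord[OF that(1)] by measurable
  qed
  have "Measurable.pred (tuple_measure n) (\<lambda>s. (\<forall>i\<in>{1..n}. 0 < \<sigma> * s i \<and> \<sigma> * s i < x) \<and>
        (\<forall>j\<in>{1..n}. \<forall>i\<in>{1..<j}. \<sigma> * s i < \<sigma> * s j))"
    by (rule pred_intros_logic, (rule pred_intros_finite(3), simp, rule bounds, assumption),
        rule pred_intros_finite(3), simp, rule pred_intros_finite(3), simp, rule chain)
  then show ?thesis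
    unfolding signed_simplex_def by (simp only: pred_def)
qed

lemma monomial_weight_measurable [measurable]:
  "monomial_weight e \<sigma> n \<in> borel_measurable (tuple_measure n)"
  unfolding monomial_weight_def by measurable

lemma monomial_weight_nonneg: "s \<in> signed_simplex \<sigma> n x \<Longrightarrow> 0 \<le> monomial_weight e \<sigma> n s"
  unfolding monomial_weight_def signed_simplex_def
  by (intro prod_nonneg zero_le_power ballI) (simp add: less_imp_le)

text \<open>The ordering conditions on the last coordinate \<open>y\<close> are exactly the upper
  bounds \<open>\<sigma> * y\<close> on all earlier ones; the bounds by \<open>x\<close> then follow
  by transitivity.\<close>

lemma signed_simplex_Suc_iff:
  assumes "s \<in> space (tuple_measure n)"
  shows "s(Suc n := y) \<in> signed_simplex \<sigma> (Suc n) x \<longleftrightarrow>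
    0 < \<sigma> * y \<and> \<sigma> * y < x \<and> s \<in> signed_simplex \<sigma> n (\<sigma> * y)"
proof -
  have "s(Suc n := y) \<in> space (tuple_measure (Suc n))"
    using assms by (auto simp: space_PiM PiE_iff extensional_def)
  then show ?thesis
    using assms unfolding signed_simplex_def
    by (auto simp: atLeastAtMostSuc_conv intro: less_trans)
qed

lemma nn_integral_monomial:
  fixes \<sigma> c x :: real
  assumes "\<bar>\<sigma>\<bar> = 1" "0 \<le> c" "0 \<le> x"
  shows "(\<integral>\<^sup>+y. ennreal (c * (\<sigma> * y) ^ m) * indicator {0<..<x} (\<sigma> * y) \<partial>lborel)
           = ennreal (c / real (m + 1) * x ^ (m + 1))"
proof -
  have "(\<integral>\<^sup>+y. ennreal (c * (\<sigma> * y) ^ m) * indicator {0<..<x} (\<sigma> * y) \<partial>lborel)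
      = (\<integral>\<^sup>+y. ennreal (c * y ^ m) * indicator {0<..<x} y \<partial>lborel)"
    \<comment> \<open>The right-hand integral is transformed by the substitution of
      \<open>\<sigma> * y\<close> for \<open>y\<close>, whose Jacobian is 1.\<close>
    using assms by (subst (2) nn_integral_real_affine[where c = \<sigma> and t = 0]) auto
  \<comment> \<open>The fundamental theorem is applied on a closed interval; the added endpoints are
    a null set.\<close>
  also have "\<dots> = (\<integral>\<^sup>+y. ennreal (c * y ^ m) * indicator {0..x} y \<partial>lborel)"
    by (intro nn_integral_cong_AE AE_I'[of "{0, x}"])
       (auto simp: null_sets_def emeasure_lborel_countable indicator_def split: if_splits)
  also have "\<dots> = ennreal (c / real (m + 1) * x ^ (m + 1) - c / real (m + 1) * 0 ^ (m + 1))"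
  proof (rule nn_integral_FTC_Icc)
    show "((\<lambda>y. c / real (m + 1) * y ^ (m + 1)) has_real_derivative c * y ^ m) (at y)" for y
      using DERIV_cmult[OF DERIV_pow[of "m + 1" y], of "c / real (m + 1)"] by simp
  qed (use assms in auto)
  finally show ?thesis by simp
qed

lemma nn_integral_signed_simplex_Suc:
  assumes "\<bar>\<sigma>\<bar> = 1" "0 \<le> c" "0 \<le> x"
    and IH: "\<And>y. 0 \<le> y \<Longrightarrow>
      (\<integral>\<^sup>+s\<in>signed_simplex \<sigma> n y. ennreal (monomial_weight e \<sigma> n s) \<partial>tuple_measure n)
        = ennreal (c * y ^ k)"
  shows "(\<integral>\<^sup>+s\<in>signed_simplex \<sigma> (Suc n) x. ennreal (monomial_weight e \<sigma> (Suc n) s)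
            \<partial>tuple_measure (Suc n))
        = ennreal (c / real (k + e (Suc n) + 1) * x ^ (k + e (Suc n) + 1))"
proof -
  interpret product_sigma_finite "\<lambda>_. lborel :: real measure" by standard
  let ?f = "\<lambda>s. ennreal (monomial_weight e \<sigma> (Suc n) s) * indicator (signed_simplex \<sigma> (Suc n) x) s"
  \<comment> \<open>Pointwise, the integrand is a factor in \<open>y\<close> alone times the
    \<open>n\<close>-dimensional integrand with upper bound \<open>\<sigma> * y\<close>. The first
    factor therefore leaves the inner integral.\<close>
  have eq: "?f (s(Suc n := y)) =
     ennreal ((\<sigma> * y) ^ e (Suc n)) * indicator {0<..<x} (\<sigma> * y) *
       (ennreal (monomial_weight e \<sigma> n s) * indicator (signed_simplex \<sigma> n (\<sigma> * y)) s)"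
    if s: "s \<in> space (tuple_measure n)" for s y
  proof (cases "0 < \<sigma> * y \<and> \<sigma> * y < x \<and> s \<in> signed_simplex \<sigma> n (\<sigma> * y)")
    case True
    have "monomial_weight e \<sigma> (Suc n) (s(Suc n := y)) = (\<sigma> * y) ^ e (Suc n) * monomial_weight e \<sigma> n s"
      unfolding monomial_weight_def by (simp add: prod.nat_ivl_Suc' cong: prod.cong_simp)
    then show ?thesis
      using True signed_simplex_Suc_iff[OF s] monomial_weight_nonneg[of s \<sigma> n "\<sigma> * y" e]
      by (simp add: ennreal_mult)
  next
    case False
    then show ?thesis
      using signed_simplex_Suc_iff[OF s, of y \<sigma> x] by (auto simp: indicator_def)
  qed
  have "?f \<in> borel_measurable (tuple_measure (Suc n))"
    by measurable
  then have "integral\<^sup>N (tuple_measure (Suc n)) ?f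
      = (\<integral>\<^sup>+y. (\<integral>\<^sup>+s. ?f (s(Suc n := y)) \<partial>tuple_measure n) \<partial>lborel)"
    using product_nn_integral_insert_rev[of "{1..n}" "Suc n" ?f]
    by (simp add: atLeastAtMostSuc_conv[symmetric])
  also have "\<dots> = (\<integral>\<^sup>+y. ennreal (c * (\<sigma> * y) ^ (k + e (Suc n))) * indicator {0<..<x} (\<sigma> * y) \<partial>lborel)"
  proof (rule nn_integral_cong)
    fix y :: real
    have "(\<integral>\<^sup>+s. ?f (s(Suc n := y)) \<partial>tuple_measure n)
        = ennreal ((\<sigma> * y) ^ e (Suc n)) * indicator {0<..<x} (\<sigma> * y) *
          (\<integral>\<^sup>+s\<in>signed_simplex \<sigma> n (\<sigma> * y). ennreal (monomial_weight e \<sigma> n s) \<partial>tuple_measure n)"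
      by (subst nn_integral_cmult[symmetric], measurable) (auto intro!: nn_integral_cong simp: eq)
    also have "\<dots> = ennreal (c * (\<sigma> * y) ^ (k + e (Suc n))) * indicator {0<..<x} (\<sigma> * y)"
    \<comment> \<open>Where \<open>\<sigma> * y\<close> is not positive, the indicator vanishes on
      both sides, so \<open>IH\<close> is used only at admissible bounds.\<close>
    proof (cases "0 < \<sigma> * y")
      case True
      then have "(\<integral>\<^sup>+s\<in>signed_simplex \<sigma> n (\<sigma> * y). ennreal (monomial_weight e \<sigma> n s) \<partial>tuple_measure n)
          = ennreal (c * (\<sigma> * y) ^ k)"
        by (intro IH) simp
      then show ?thesis
        using True assms(2) by (simp add: indicator_def ennreal_mult[symmetric] power_add mult_ac)
    qed auto
    finally show "(\<integral>\<^sup>+s. ?f (s(Suc n := y)) \<partial>tuple_measure n)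
        = ennreal (c * (\<sigma> * y) ^ (k + e (Suc n))) * indicator {0<..<x} (\<sigma> * y)" .
  qed
  also have "\<dots> = ennreal (c / real (k + e (Suc n) + 1) * x ^ (k + e (Suc n) + 1))"
    by (rule nn_integral_monomial) (use assms in auto)
  finally show ?thesis .
qed

section \<open>Taylor coefficients as values of the integrals\<close>

text \<open>The Taylor coefficients of \<open>u\<^sub>1\<close> for \<open>p = 0\<close> and of \<open>u\<^sub>2\<close> for \<open>p = 1\<close>.\<close>

fun airy_coeff :: "nat \<Rightarrow> nat \<Rightarrow> real" where
  "airy_coeff p 0 = of_bool (p = 0)"
| "airy_coeff p (Suc 0) = of_bool (p = 1)"
| "airy_coeff p (Suc (Suc 0)) = 0"
| "airy_coeff p (Suc (Suc (Suc n))) = airy_coeff p n / (real (n + 2) * real (n + 3))"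

lemma airy_coeff_nonneg: "0 \<le> airy_coeff p n"
  by (induction p n rule: airy_coeff.induct) auto

lemma airy_coeff_progression_Suc:
  "airy_coeff p (3 * Suc j + p) = airy_coeff p (3 * j + p) / (real (3 * j + p + 2) * real (3 * j + p + 3))"
proof -
  have "3 * Suc j + p = Suc (Suc (Suc (3 * j + p)))"
    by simp
  then show ?thesis
    by (simp only: airy_coeff.simps)
qed

lemma airy_coeff_initial: "p \<le> 1 \<Longrightarrow> airy_coeff p p = 1"
  by (cases p) auto

text \<open>The recursion advances in steps of three, and among the indices 0, 1, 2 only
  \<open>p\<close> starts with a nonzero coefficient.\<close>

lemma airy_coeff_eq_0: "p \<le> 1 \<Longrightarrow> n mod 3 \<noteq> p \<Longrightarrow> airy_coeff p n = 0"
proof (induction p n rule: airy_coeff.induct)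
  case (4 p n)
  have "Suc (Suc (Suc n)) mod 3 = n mod 3"
    by presburger
  with 4 show ?case by simp
qed auto

text \<open>For \<open>p = 0\<close> the weight selects the odd coordinates, for
  \<open>p = 1\<close> the even ones. The induction adds two coordinates at a time; it starts from a
  point for \<open>p = 0\<close> and from an interval with weight 1 for
  \<open>p = 1\<close>.\<close>

lemma nn_integral_airy_weight:
  assumes \<sigma>: "\<bar>\<sigma>\<bar> = 1" and p: "p \<le> 1" and "0 \<le> x"
  shows "(\<integral>\<^sup>+s\<in>signed_simplex \<sigma> (2 * j + p) x.
            ennreal (monomial_weight (\<lambda>i. of_bool (odd (i + p))) \<sigma> (2 * j + p) s)
            \<partial>tuple_measure (2 * j + p))
        = ennreal (airy_coeff p (3 * j + p) * x ^ (3 * j + p))"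
  using \<open>0 \<le> x\<close>
proof (induction j arbitrary: x)
  case 0
  interpret product_sigma_finite "\<lambda>_. lborel :: real measure" by standard
  have zero: "(\<integral>\<^sup>+s\<in>signed_simplex \<sigma> 0 y. ennreal (monomial_weight e \<sigma> 0 s) \<partial>tuple_measure 0)
      = ennreal (1 * y ^ 0)" for y e
    by (simp add: nn_integral_empty signed_simplex_def monomial_weight_def space_PiM)
  have "p = 0 \<or> p = 1"
    using p by auto
  then show ?case
    using zero nn_integral_signed_simplex_Suc[OF \<sigma> _ 0 zero, of "\<lambda>i. of_bool (odd (i + 1))"] by auto
next
  case (Suc j)
  let ?e = "\<lambda>i. of_bool (odd (i + p)) :: nat"
  let ?n = "2 * j + p" and ?k = "3 * j + p"
  \<comment> \<open>The coordinate with index \<open>Suc ?n\<close> occurs in the product, so the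
    degree rises by 2, with divisor \<open>?k + 2\<close>. The one after it does not occur, so the
    degree rises by 1, with divisor \<open>?k + 3\<close>.\<close>
  have one: "(\<integral>\<^sup>+s\<in>signed_simplex \<sigma> (Suc ?n) y. ennreal (monomial_weight ?e \<sigma> (Suc ?n) s)
      \<partial>tuple_measure (Suc ?n)) = ennreal (airy_coeff p ?k / real (?k + 2) * y ^ (?k + 2))"
    if "0 \<le> y" for y
    using nn_integral_signed_simplex_Suc[OF \<sigma> airy_coeff_nonneg that Suc.IH] by simp
  have "0 \<le> airy_coeff p ?k / real (?k + 2)"
    by (simp add: airy_coeff_nonneg)
  from nn_integral_signed_simplex_Suc[OF \<sigma> this Suc.prems one]
  show ?case
    unfolding airy_coeff_progression_Suc by (simp add: algebra_simps power_add power3_eq_cube)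
qed

lemma has_bochner_integral_airy_weight:
  assumes "\<bar>\<sigma>\<bar> = 1" "p \<le> 1" "0 \<le> x"
  shows "has_bochner_integral (tuple_measure (2 * j + p))
     (\<lambda>s. indicator (signed_simplex \<sigma> (2 * j + p) x) s *
        monomial_weight (\<lambda>i. of_bool (odd (i + p))) \<sigma> (2 * j + p) s)
     (airy_coeff p (3 * j + p) * x ^ (3 * j + p))"
proof (rule has_bochner_integral_nn_integral)
  let ?w = "monomial_weight (\<lambda>i. of_bool (odd (i + p))) \<sigma> (2 * j + p)"
  show "(\<lambda>s. indicator (signed_simplex \<sigma> (2 * j + p) x) s * ?w s) \<in> borel_measurable (tuple_measure (2 * j + p))"
    by measurable
  show "AE s in tuple_measure (2 * j + p). 0 \<le> indicator (signed_simplex \<sigma> (2 * j + p) x) s * ?w s"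
    using monomial_weight_nonneg by (intro AE_I2) (auto simp: indicator_def)
  have "(\<integral>\<^sup>+s. ennreal (indicator (signed_simplex \<sigma> (2 * j + p) x) s * ?w s) \<partial>tuple_measure (2 * j + p))
      = (\<integral>\<^sup>+s\<in>signed_simplex \<sigma> (2 * j + p) x. ennreal (?w s) \<partial>tuple_measure (2 * j + p))"
    by (intro nn_integral_cong) (auto simp: indicator_def)
  then show "(\<integral>\<^sup>+s. ennreal (indicator (signed_simplex \<sigma> (2 * j + p) x) s * ?w s) \<partial>tuple_measure (2 * j + p))
      = ennreal (airy_coeff p (3 * j + p) * x ^ (3 * j + p))"
    using nn_integral_airy_weight[OF assms] by simp
qed (use assms airy_coeff_nonneg in auto)

section \<open>Regions and products of the theorem in signed form\<close>

text \<open>Chaining the inequalities between neighbours gives all pairwise ones and carries the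
  bounds at the two ends to every coordinate. For \<open>n = 0\<close> the chain form would refer to
  \<open>s 1\<close> and \<open>s 0\<close>, which lie outside the index set.\<close>

lemma signed_simplex_eq_chain:
  assumes "1 \<le> n"
  shows "signed_simplex \<sigma> n x =
    {s \<in> {1..n} \<rightarrow>\<^sub>E UNIV. 0 < \<sigma> * s 1 \<and> (\<forall>i\<in>{1..<n}. \<sigma> * s i < \<sigma> * s (i + 1)) \<and> \<sigma> * s n < x}"
    (is "_ = ?R")
proof (intro equalityI subsetI)
  fix s assume "s \<in> signed_simplex \<sigma> n x"
  then show "s \<in> ?R"
    using assms by (auto simp: signed_simplex_def space_PiM)
next
  fix s assume s: "s \<in> ?R"
  have mono: "\<sigma> * s i < \<sigma> * s j" if "1 \<le> i" "i < j" "j \<le> n" for i j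
    using that(2,1,3)
  proof (induction rule: strict_inc_induct)
    case (base i)
    then show ?case using s by auto
  next
    case (step i)
    then have "\<sigma> * s i < \<sigma> * s (i + 1)" "\<sigma> * s (Suc i) < \<sigma> * s j"
      using s by auto
    then show ?case by simp
  qed
  have "0 < \<sigma> * s i \<and> \<sigma> * s i < x" if "i \<in> {1..n}" for i
    using that s mono[of 1 i] mono[of i n] by (cases "i = 1"; cases "i = n") auto
  then show "s \<in> signed_simplex \<sigma> n x"
    using s mono by (auto simp: signed_simplex_def space_PiM)
qed

lemma increasing_tuples_eq: "1 \<le> n \<Longrightarrow> increasing_tuples n x = signed_simplex 1 n x"
  by (simp add: signed_simplex_eq_chain increasing_tuples_def)

lemma decreasing_tuples_eq: "1 \<le> n \<Longrightarrow> decreasing_tuples n x = signed_simplex (-1) n (-x)"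
  by (auto simp add: signed_simplex_eq_chain decreasing_tuples_def)

text \<open>Each of the \<open>j\<close> factors is written as \<open>\<sigma>\<close> times
  \<open>\<sigma> * s i\<close>, using \<open>\<sigma> * \<sigma> = 1\<close>. The terms
  \<open>+ 0\<close> display the instance \<open>p = 0\<close> of the general weight.\<close>

lemma odd_product_eq:
  assumes "\<bar>\<sigma>\<bar> = 1"
  shows "odd_product j s = \<sigma> ^ j * monomial_weight (\<lambda>i. of_bool (odd (i + 0))) \<sigma> (2 * j + 0) s"
proof (induction j)
  case 0
  then show ?case by (simp add: odd_product_def monomial_weight_def)
next
  case (Suc j)
  have "\<sigma> * \<sigma> = 1"
    using assms by (metis abs_mult_self_eq mult_1)
  then show ?case
    using Suc by (simp add: odd_product_def monomial_weight_def mult_ac)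
qed

lemma even_product_eq:
  assumes "\<bar>\<sigma>\<bar> = 1"
  shows "even_product (Suc j) s = \<sigma> ^ j * monomial_weight (\<lambda>i. of_bool (odd (i + 1))) \<sigma> (2 * j + 1) s"
proof (induction j)
  case 0
  then show ?case by (simp add: even_product_def monomial_weight_def)
next
  case (Suc j)
  have "\<sigma> * \<sigma> = 1"
    using assms by (metis abs_mult_self_eq mult_1)
  then show ?case
    using Suc by (simp add: even_product_def monomial_weight_def mult_ac)
qed

text \<open>The sign \<open>\<sigma> ^ j\<close> of the product equals
  \<open>\<sigma> ^ (3 * j)\<close> and is absorbed into the power, giving the Taylor term at the
  actual point \<open>\<sigma> * x\<close>.\<close>

lemma has_bochner_integral_odd_product:
  assumes "\<bar>\<sigma>\<bar> = 1" "0 \<le> x"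
  shows "has_bochner_integral (tuple_measure (2 * j))
     (\<lambda>s. indicator (signed_simplex \<sigma> (2 * j) x) s *\<^sub>R odd_product j s)
     (airy_coeff 0 (3 * j) * (\<sigma> * x) ^ (3 * j))"
proof -
  have "\<sigma> ^ (3 * j) = \<sigma> ^ j"
    using assms(1) by (auto simp: abs_if power_mult split: if_splits)
  then show ?thesis
    using has_bochner_integral_mult_right[OF has_bochner_integral_airy_weight[OF assms(1) _ assms(2), of 0 j], of "\<sigma> ^ j"]
    by (simp add: odd_product_eq[OF assms(1)] power_mult_distrib mult_ac)
qed

text \<open>Here the power \<open>3 * j + 1\<close> absorbs one sign more than the product supplies.
  The compensating factor \<open>\<sigma>\<close> is the source of the minus sign in the formula for
  \<open>airy_u2\<close> at negative arguments.\<close>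

lemma has_bochner_integral_even_product:
  assumes "\<bar>\<sigma>\<bar> = 1" "0 \<le> x"
  shows "has_bochner_integral (tuple_measure (2 * j + 1))
     (\<lambda>s. indicator (signed_simplex \<sigma> (2 * j + 1) x) s *\<^sub>R even_product (Suc j) s)
     (\<sigma> * (airy_coeff 1 (3 * j + 1) * (\<sigma> * x) ^ (3 * j + 1)))"
proof -
  have "\<sigma> ^ (3 * j) = \<sigma> ^ j" "\<sigma> * \<sigma> = 1"
    using assms(1) by (auto simp: abs_if power_mult split: if_splits)
  then have *: "\<sigma> * (c * (\<sigma> * x) ^ (3 * j + 1)) = \<sigma> ^ j * (c * x ^ (3 * j + 1))" for c
    by (simp add: power_mult_distrib)
  show ?thesis
    unfolding *
    using has_bochner_integral_mult_right[OF has_bochner_integral_airy_weight[OF assms(1) _ assms(2), of 1 j], of "\<sigma> ^ j"]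
    by (simp add: even_product_eq[OF assms(1)] mult_ac)
qed

section \<open>Convergence of the power series and the Airy equation\<close>

definition airy_series :: "nat \<Rightarrow> real \<Rightarrow> real" where
  "airy_series p x = (\<Sum>n. airy_coeff p n * x ^ n)"

definition airy_series_deriv :: "nat \<Rightarrow> real \<Rightarrow> real" where
  "airy_series_deriv p x = (\<Sum>n. diffs (airy_coeff p) n * x ^ n)"

text \<open>A crude bound, sufficient for comparison with an exponential series: each step divides
  by at least \<open>Suc j\<close>.\<close>

lemma airy_coeff_le: "p \<le> 1 \<Longrightarrow> airy_coeff p (3 * j + p) \<le> 1 / fact j"
proof (induction j)
  case 0
  then show ?case by (simp add: airy_coeff_initial)
next
  case (Suc j)
  have "real (Suc j) * 1 \<le> real (3 * j + p + 2) * real (3 * j + p + 3)"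
    by (intro mult_mono) auto
  then have "airy_coeff p (3 * j + p) / (real (3 * j + p + 2) * real (3 * j + p + 3))
      \<le> (1 / fact j) / (real (Suc j) * 1)"
    using Suc by (intro frac_le) auto
  then show ?case
    unfolding airy_coeff_progression_Suc by (simp add: field_simps)
qed

lemma airy_coeff_progression_sums:
  assumes "p \<le> 1"
  shows "(\<lambda>j. airy_coeff p (3 * j + p) * x ^ (3 * j + p)) sums airy_series p x"
    and summable_airy_coeff: "summable (\<lambda>n. airy_coeff p n * x ^ n)"
proof -
  have mono: "strict_mono (\<lambda>j. 3 * j + p)"
    by (auto intro: strict_monoI)
  have zero: "airy_coeff p n * x ^ n = 0" if "n \<notin> range (\<lambda>j. 3 * j + p)" for n
    
  proof -
    have "n mod 3 \<noteq> p"
    proof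
      assume "n mod 3 = p"
      then have "n = 3 * (n div 3) + p" by presburger
      with that show False by blast
    qed
    then show ?thesis using airy_coeff_eq_0[OF assms] by simp
  qed
  \<comment> \<open>The majorant sums to \<open>\<bar>x\<bar> ^ p\<close> times the exponential of
    \<open>\<bar>x\<bar> ^ 3\<close>.\<close>
  have "summable (\<lambda>j. \<bar>x\<bar> ^ p * (inverse (fact j) * (\<bar>x\<bar> ^ 3) ^ j))"
    by (intro summable_mult summable_exp)
  moreover have "norm (airy_coeff p (3 * j + p) * x ^ (3 * j + p))
      \<le> \<bar>x\<bar> ^ p * (inverse (fact j) * (\<bar>x\<bar> ^ 3) ^ j)" for j
  proof -
    have "norm (airy_coeff p (3 * j + p) * x ^ (3 * j + p)) = airy_coeff p (3 * j + p) * \<bar>x\<bar> ^ (3 * j + p)"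
      by (simp add: abs_mult power_abs airy_coeff_nonneg)
    also have "\<dots> \<le> 1 / fact j * \<bar>x\<bar> ^ (3 * j + p)"
      by (intro mult_right_mono airy_coeff_le assms) auto
    also have "\<dots> = \<bar>x\<bar> ^ p * (inverse (fact j) * (\<bar>x\<bar> ^ 3) ^ j)"
      unfolding power_add power_mult by (simp add: divide_inverse)
    finally show ?thesis .
  qed
  ultimately have "summable (\<lambda>j. airy_coeff p (3 * j + p) * x ^ (3 * j + p))"
    by (rule summable_comparison_test'[where N = 0])
  then show summ: "summable (\<lambda>n. airy_coeff p n * x ^ n)"
    using summable_mono_reindex[of _ "\<lambda>n. airy_coeff p n * x ^ n", OF mono zero] by simp
  then show "(\<lambda>j. airy_coeff p (3 * j + p) * x ^ (3 * j + p)) sums airy_series p x"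
    using sums_mono_reindex[of _ "\<lambda>n. airy_coeff p n * x ^ n", OF mono zero] by (simp add: airy_series_def summable_sums)
qed

lemma airy_series_has_derivative:
  assumes "p \<le> 1"
  shows "(airy_series p has_real_derivative airy_series_deriv p x) (at x)"
  unfolding airy_series_def airy_series_deriv_def
  by (rule termdiffs_strong_converges_everywhere) (rule summable_airy_coeff[OF assms])

text \<open>Differentiating twice multiplies the coefficient of index \<open>n + 3\<close> by
  \<open>(n + 2) * (n + 3)\<close>, which cancels the divisor in the recursion. What remains is the
  original series shifted by one power of \<open>x\<close>.\<close>

lemma airy_series_deriv_has_derivative:
  assumes "p \<le> 1"
  shows "(airy_series_deriv p has_real_derivative x * airy_series p x) (at x)"
proof -
  let ?dd = "\<lambda>n. diffs (diffs (airy_coeff p)) n * x ^ n"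
  have dd: "?dd (Suc n) = x * (airy_coeff p n * x ^ n)" for n
  proof -
    have cancel: "a * (b * (d / (a * b))) = d" if "a \<noteq> 0" "b \<noteq> 0" for a b d :: real
      using that by simp
    have "diffs (diffs (airy_coeff p)) (Suc n)
        = real (n + 2) * (real (n + 3) * airy_coeff p (Suc (Suc (Suc n))))"
      by (simp add: diffs_def add_ac del: airy_coeff.simps)
    also have "\<dots> = airy_coeff p n"
      unfolding airy_coeff.simps(4) by (intro cancel) linarith+
    finally show ?thesis by simp
  qed
  have "(\<lambda>n. ?dd (Suc n)) sums (x * airy_series p x)"
    unfolding dd airy_series_def by (intro sums_mult summable_sums summable_airy_coeff assms)
  \<comment> \<open>The term at index 0 is twice the coefficient of index 2, hence zero.\<close>
  then have "?dd sums (x * airy_series p x + ?dd 0)"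
    by (rule sums_Suc)
  then have "(\<Sum>n. ?dd n) = x * airy_series p x"
    by (simp add: sums_iff diffs_def numeral_2_eq_2)
  moreover have "(airy_series_deriv p has_real_derivative (\<Sum>n. ?dd n)) (at x)"
    unfolding airy_series_deriv_def
    by (rule termdiffs_strong_converges_everywhere)
       (rule termdiff_converges_all, rule summable_airy_coeff[OF assms])
  ultimately show ?thesis by simp
qed

lemma airy_series_0: "airy_series p 0 = of_bool (p = 0)"
  by (simp add: airy_series_def powser_zero)

lemma airy_series_deriv_0: "airy_series_deriv p 0 = of_bool (p = 1)"
  by (simp add: airy_series_deriv_def powser_zero diffs_def)

section \<open>The series of integrals as power series\<close>

lemma right_terms_eq:
  assumes "0 \<le> x"
  shows "1 \<le> j \<Longrightarrow> u1_right_term j x = airy_coeff 0 (3 * j) * x ^ (3 * j)"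
    and "u2_right_term (Suc j) x = airy_coeff 1 (3 * j + 1) * x ^ (3 * j + 1)"
  using has_bochner_integral_integral_eq[OF has_bochner_integral_odd_product[of 1 x j]]
    has_bochner_integral_integral_eq[OF has_bochner_integral_even_product[of 1 x j]] assms
  by (auto simp: u1_right_term_def u2_right_term_def set_lebesgue_integral_def increasing_tuples_eq)

text \<open>The reflected simplex has bound \<open>- x\<close>, and reflecting back gives the point
  \<open>(-1) * (- x) = x\<close>. Hence the same Taylor terms appear as on the right, up to the
  sign for \<open>u2_left_term\<close>.\<close>

lemma left_terms_eq:
  assumes "x \<le> 0"
  shows "1 \<le> j \<Longrightarrow> u1_left_term j x = airy_coeff 0 (3 * j) * x ^ (3 * j)"
    and "u2_left_term (Suc j) x = - (airy_coeff 1 (3 * j + 1) * x ^ (3 * j + 1))"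
  using has_bochner_integral_integral_eq[OF has_bochner_integral_odd_product[of "-1" "-x" j]]
    has_bochner_integral_integral_eq[OF has_bochner_integral_even_product[of "-1" "-x" j]] assms
  by (auto simp: u1_left_term_def u2_left_term_def set_lebesgue_integral_def decreasing_tuples_eq)

lemma set_integrable_products:
  assumes "1 \<le> j"
  shows "0 \<le> x \<Longrightarrow> set_integrable (tuple_measure (2 * j)) (increasing_tuples (2 * j) x) (odd_product j)"
    and "0 \<le> x \<Longrightarrow> set_integrable (tuple_measure (2 * j - 1)) (increasing_tuples (2 * j - 1) x) (even_product j)"
    and "x \<le> 0 \<Longrightarrow> set_integrable (tuple_measure (2 * j)) (decreasing_tuples (2 * j) x) (odd_product j)"
    and "x \<le> 0 \<Longrightarrow> set_integrable (tuple_measure (2 * j - 1)) (decreasing_tuples (2 * j - 1) x) (even_product j)"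
proof -
  obtain i where j: "j = Suc i"
    using assms by (cases j) auto
  have "0 \<le> x \<Longrightarrow> set_integrable (tuple_measure (2 * j)) (signed_simplex 1 (2 * j) x) (odd_product j)"
    "0 \<le> x \<Longrightarrow> set_integrable (tuple_measure (2 * i + 1)) (signed_simplex 1 (2 * i + 1) x) (even_product (Suc i))"
    "x \<le> 0 \<Longrightarrow> set_integrable (tuple_measure (2 * j)) (signed_simplex (-1) (2 * j) (-x)) (odd_product j)"
    "x \<le> 0 \<Longrightarrow> set_integrable (tuple_measure (2 * i + 1)) (signed_simplex (-1) (2 * i + 1) (-x)) (even_product (Suc i))"
    unfolding set_integrable_def
    by (intro integrable.intros[OF has_bochner_integral_odd_product]
          integrable.intros[OF has_bochner_integral_even_product]; simp)+
  then show "0 \<le> x \<Longrightarrow> set_integrable (tuple_measure (2 * j)) (increasing_tuples (2 * j) x) (odd_product j)"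
    "0 \<le> x \<Longrightarrow> set_integrable (tuple_measure (2 * j - 1)) (increasing_tuples (2 * j - 1) x) (even_product j)"
    "x \<le> 0 \<Longrightarrow> set_integrable (tuple_measure (2 * j)) (decreasing_tuples (2 * j) x) (odd_product j)"
    "x \<le> 0 \<Longrightarrow> set_integrable (tuple_measure (2 * j - 1)) (decreasing_tuples (2 * j - 1) x) (even_product j)"
    using assms by (simp_all add: increasing_tuples_eq decreasing_tuples_eq j)
qed

text \<open>The summand 1 in the formulas for \<open>airy_u1\<close> is the Taylor term at
  \<open>j = 0\<close>, removed here.\<close>

lemma airy_series_0_tail_sums:
  "(\<lambda>j. airy_coeff 0 (3 * Suc j) * x ^ (3 * Suc j)) sums (airy_series 0 x - 1)"
  using airy_coeff_progression_sums[of 0 x]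
    sums_Suc_iff[of "\<lambda>j. airy_coeff 0 (3 * j) * x ^ (3 * j)" "airy_series 0 x - 1"]
  by simp

lemma right_term_sums:
  assumes "0 \<le> x"
  shows "(\<lambda>j. u1_right_term (Suc j) x) sums (airy_series 0 x - 1)"
    and "(\<lambda>j. u2_right_term (Suc j) x) sums airy_series 1 x"
proof -
  have "u1_right_term (Suc j) x = airy_coeff 0 (3 * Suc j) * x ^ (3 * Suc j)" for j
    by (rule right_terms_eq(1)[OF assms]) simp
  then show "(\<lambda>j. u1_right_term (Suc j) x) sums (airy_series 0 x - 1)"
    using airy_series_0_tail_sums[of x] by simp
  show "(\<lambda>j. u2_right_term (Suc j) x) sums airy_series 1 x"
    unfolding right_terms_eq(2)[OF assms] by (rule airy_coeff_progression_sums) simp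
qed

lemma left_term_sums:
  assumes "x \<le> 0"
  shows "(\<lambda>j. u1_left_term (Suc j) x) sums (airy_series 0 x - 1)"
    and "(\<lambda>j. u2_left_term (Suc j) x) sums - airy_series 1 x"
proof -
  have "u1_left_term (Suc j) x = airy_coeff 0 (3 * Suc j) * x ^ (3 * Suc j)" for j
    by (rule left_terms_eq(1)[OF assms]) simp
  then show "(\<lambda>j. u1_left_term (Suc j) x) sums (airy_series 0 x - 1)"
    using airy_series_0_tail_sums[of x] by simp
  show "(\<lambda>j. u2_left_term (Suc j) x) sums - airy_series 1 x"
    unfolding left_terms_eq(2)[OF assms] by (intro sums_minus airy_coeff_progression_sums) simp
qed

text \<open>Both branches of the definition sum to the same everywhere convergent power series, so
  differentiability at 0 needs no gluing argument.\<close>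

lemma airy_u1_eq: "airy_u1 x = airy_series 0 x"
  using right_term_sums(1)[of x] left_term_sums(1)[of x] by (auto simp: airy_u1_def sums_iff)

lemma airy_u2_eq: "airy_u2 x = airy_series 1 x"
  using right_term_sums(2)[of x] left_term_sums(2)[of x] by (auto simp: airy_u2_def sums_iff)

lemma airy_u_has_derivative:
  "(airy_u1 has_real_derivative airy_series_deriv 0 x) (at x)"
  "(airy_u2 has_real_derivative airy_series_deriv 1 x) (at x)"
  using airy_series_has_derivative[of 0 x] airy_series_has_derivative[of 1 x]
  unfolding airy_u1_eq[abs_def] airy_u2_eq[abs_def] by simp_all

lemma airy_u_deriv_has_derivative:
  "(airy_series_deriv 0 has_real_derivative x * airy_u1 x) (at x)"
  "(airy_series_deriv 1 has_real_derivative x * airy_u2 x) (at x)"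
  using airy_series_deriv_has_derivative[of 0 x] airy_series_deriv_has_derivative[of 1 x]
  unfolding airy_u1_eq airy_u2_eq by simp_all

lemma airy_u_at_0: "airy_u1 0 = 1" "airy_u2 0 = 0"
  by (simp_all add: airy_u1_eq airy_u2_eq airy_series_0)

section \<open>The solution space, by Wronskians\<close>

lemma has_vector_derivative_of_real_scale:
  fixes a :: "'a::real_normed_field"
  assumes "(f has_real_derivative D) (at x)"
  shows "((\<lambda>x. a * of_real (f x)) has_vector_derivative a * of_real D) (at x)"
  using assms by (intro has_vector_derivative_mult_right has_vector_derivative_of_real)
    (simp add: has_real_derivative_iff_has_vector_derivative)

lemma airy_combination_solution:
  fixes a b :: "'a::real_normed_field"
  defines "u \<equiv> \<lambda>x. a * of_real (airy_u1 x) + b * of_real (airy_u2 x)"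
  shows "airy_solution u" "u 0 = a" "vector_derivative u (at 0) = b"
proof -
  let ?u' = "\<lambda>x. a * of_real (airy_series_deriv 0 x) + b * of_real (airy_series_deriv 1 x)"
  have d1: "(u has_vector_derivative ?u' x) (at x)" for x
    unfolding u_def
    by (intro has_vector_derivative_add has_vector_derivative_of_real_scale airy_u_has_derivative)
  have "(?u' has_vector_derivative a * of_real (x * airy_u1 x) + b * of_real (x * airy_u2 x)) (at x)" for x
    by (intro has_vector_derivative_add has_vector_derivative_of_real_scale airy_u_deriv_has_derivative)
  then have "(?u' has_vector_derivative of_real x * u x) (at x)" for x
    by (simp add: u_def algebra_simps)
  with d1 show "airy_solution u"
    unfolding airy_solution_def by (intro exI[of _ ?u']) simp
  show "u 0 = a"
    by (simp add: u_def airy_u_at_0)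
  show "vector_derivative u (at 0) = b"
    using vector_derivative_at[OF d1[of 0]] by (simp add: airy_series_deriv_0)
qed

lemma airy_wronskian_constant:
  fixes u :: "real \<Rightarrow> 'a::real_normed_field"
  assumes u: "\<And>x. (u has_vector_derivative u' x) (at x)"
      "\<And>x. (u' has_vector_derivative of_real x * u x) (at x)"
    and v: "\<And>x. (v has_vector_derivative v' x) (at x)"
      "\<And>x. (v' has_vector_derivative of_real x * v x) (at x)"
  shows "u x * v' x - u' x * v x = u 0 * v' 0 - u' 0 * v 0"
proof -
  have "((\<lambda>x. u x * v' x - u' x * v x) has_vector_derivative
      (u x * (of_real x * v x) + u' x * v' x) - (u' x * v' x + of_real x * u x * v x)) (at x)" for x
    by (intro has_vector_derivative_diff has_vector_derivative_mult u v)
  then have "((\<lambda>x. u x * v' x - u' x * v x) has_vector_derivative 0) (at x within UNIV)" for x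
    by (simp add: algebra_simps)
  from has_vector_derivative_zero_constant[OF convex_UNIV this]
  obtain c where "\<And>x. u x * v' x - u' x * v x = c" by auto
  then show ?thesis by simp
qed

lemma airy_solution_eq:
  fixes u :: "real \<Rightarrow> 'a::real_normed_field"
  assumes "airy_solution u"
  shows "u x = u 0 * of_real (airy_u1 x) + vector_derivative u (at 0) * of_real (airy_u2 x)"
proof -
  obtain u' where u: "\<And>x. (u has_vector_derivative u' x) (at x)"
      "\<And>x. (u' has_vector_derivative of_real x * u x) (at x)"
    using assms unfolding airy_solution_def by blast
  define v1 v2 v1' v2' :: "real \<Rightarrow> 'a" where
    "v1 = (\<lambda>x. of_real (airy_u1 x))" and "v2 = (\<lambda>x. of_real (airy_u2 x))" and
    "v1' = (\<lambda>x. of_real (airy_series_deriv 0 x))" and "v2' = (\<lambda>x. of_real (airy_series_deriv 1 x))"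
  have v1: "(v1 has_vector_derivative v1' x) (at x)" "(v1' has_vector_derivative of_real x * v1 x) (at x)" for x
    using has_vector_derivative_of_real_scale[OF airy_u_has_derivative(1), of "1::'a" x]
      has_vector_derivative_of_real_scale[OF airy_u_deriv_has_derivative(1), of "1::'a" x]
    by (simp_all add: v1_def v1'_def)
  have v2: "(v2 has_vector_derivative v2' x) (at x)" "(v2' has_vector_derivative of_real x * v2 x) (at x)" for x
    using has_vector_derivative_of_real_scale[OF airy_u_has_derivative(2), of "1::'a" x]
      has_vector_derivative_of_real_scale[OF airy_u_deriv_has_derivative(2), of "1::'a" x]
    by (simp_all add: v2_def v2'_def)
  have at_0: "v1 0 = 1" "v2 0 = 0" "v1' 0 = 0" "v2' 0 = 1"
    by (simp_all add: v1_def v2_def v1'_def v2'_def airy_u_at_0 airy_series_deriv_0)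
  have w1: "u x * v1' x - u' x * v1 x = - u' 0"
    using airy_wronskian_constant[OF u v1] at_0 by simp
  have w2: "u x * v2' x - u' x * v2 x = u 0"
    using airy_wronskian_constant[OF u v2] at_0 by simp
  have w: "v1 x * v2' x - v1' x * v2 x = 1"
    using airy_wronskian_constant[OF v1 v2] at_0 by simp
  \<comment> \<open>Cramer's rule: multiplying by the Wronskian 1 of \<open>v1\<close> and
    \<open>v2\<close> and regrouping expresses \<open>u x\<close> through the Wronskians of
    \<open>u\<close> with \<open>v1\<close> and \<open>v2\<close>, which are known from the values
    at 0.\<close>
  have "u x = u x * (v1 x * v2' x - v1' x * v2 x)"
    by (simp add: w)
  also have "\<dots> = (u x * v2' x - u' x * v2 x) * v1 x - (u x * v1' x - u' x * v1 x) * v2 x"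
    by (simp add: algebra_simps)
  also have "\<dots> = u 0 * v1 x + u' 0 * v2 x"
    by (simp add: w1 w2)
  finally show ?thesis
    using vector_derivative_at[OF u(1)] by (simp add: v1_def v2_def)
qed

text \<open>Evaluates the definite descriptions behind \<open>Ai\<close> and \<open>Bi\<close>: the
  combination supplies existence, and \<open>airy_solution_eq\<close> supplies uniqueness.\<close>

lemma the_airy_solution:
  fixes a b :: real
  shows "(THE u. airy_solution u \<and> u 0 = a \<and> vector_derivative u (at 0) = b)
    = (\<lambda>x. a * airy_u1 x + b * airy_u2 x)"
proof (rule the_equality)
  show "airy_solution (\<lambda>x. a * airy_u1 x + b * airy_u2 x) \<and> a * airy_u1 0 + b * airy_u2 0 = a \<and>
      vector_derivative (\<lambda>x. a * airy_u1 x + b * airy_u2 x) (at 0) = b"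
    using airy_combination_solution[of a b] by simp
next
  fix u assume "airy_solution u \<and> u 0 = a \<and> vector_derivative u (at 0) = b"
  then show "u = (\<lambda>x. a * airy_u1 x + b * airy_u2 x)"
    using airy_solution_eq[of u] by auto
qed

theorem mainTheorem6:
  shows
    "(\<forall>x\<ge>0. \<forall>j\<ge>1.
        set_integrable (tuple_measure (2 * j)) (increasing_tuples (2 * j) x) (odd_product j) \<and>
        set_integrable (tuple_measure (2 * j - 1)) (increasing_tuples (2 * j - 1) x) (even_product j)) \<and>
     (\<forall>x\<le>0. \<forall>j\<ge>1.
        set_integrable (tuple_measure (2 * j)) (decreasing_tuples (2 * j) x) (odd_product j) \<and>
        set_integrable (tuple_measure (2 * j - 1)) (decreasing_tuples (2 * j - 1) x) (even_product j)) \<and>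
     (\<forall>x\<ge>0. summable (\<lambda>j. u1_right_term (Suc j) x) \<and>
              airy_u1 x = 1 + (\<Sum>j. u1_right_term (Suc j) x)) \<and>
     (\<forall>x\<ge>0. summable (\<lambda>j. u2_right_term (Suc j) x) \<and>
              airy_u2 x = (\<Sum>j. u2_right_term (Suc j) x)) \<and>
     (\<forall>x\<le>0. summable (\<lambda>j. u1_left_term (Suc j) x) \<and>
              airy_u1 x = 1 + (\<Sum>j. u1_left_term (Suc j) x)) \<and>
     (\<forall>x\<le>0. summable (\<lambda>j. u2_left_term (Suc j) x) \<and>
              airy_u2 x = - (\<Sum>j. u2_left_term (Suc j) x)) \<and>
     (\<forall>u :: real \<Rightarrow> 'a::real_normed_field. airy_solution u \<longrightarrow>
        (\<forall>x. u x = u 0 * of_real (airy_u1 x) + vector_derivative u (at 0) * of_real (airy_u2 x))) \<and>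
     (\<forall>a b :: 'a. let u = (\<lambda>x. a * of_real (airy_u1 x) + b * of_real (airy_u2 x)) in
        airy_solution u \<and> u 0 = a \<and> vector_derivative u (at 0) = b) \<and>
     (\<forall>x. Ai x = airy_u1 x / (3 powr (2/3) * Gamma (2/3))
                  - airy_u2 x / (3 powr (1/3) * Gamma (1/3))) \<and>
     (\<forall>x. Bi x = airy_u1 x / (3 powr (1/6) * Gamma (2/3))
                  + 3 powr (1/6) * airy_u2 x / Gamma (1/3))"
proof (intro conjI allI impI, goal_cases)
  \<comment> \<open>Goals 1 to 4 (integrability) and 5 to 12 (summability and values of the four
    series) are left to the closing method. At \<open>x = 0\<close> the left formulas hold as well,
    since both sides are rewritten to \<open>airy_series\<close>.\<close>
  case (13 u x)
  then show ?case by (rule airy_solution_eq)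
next
  case (14 a b)
  show ?case
    using airy_combination_solution[of a b] by (simp add: Let_def)
next
  case (15 x)
  show ?case
    unfolding Ai_def the_airy_solution by simp
next
  case (16 x)
  show ?case
    unfolding Bi_def the_airy_solution by simp
qed ((rule set_integrable_products; assumption) |
     simp add: airy_u1_eq airy_u2_eq
       right_term_sums[THEN sums_summable] left_term_sums[THEN sums_summable]
       right_term_sums[THEN sums_unique, symmetric] left_term_sums[THEN sums_unique, symmetric])+

end
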